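(* Let $n\ge2$, and write $B_n(i,j)=M_n^{2,2}(i,j)$ and $b_n(i,j)=m_n^{2,2}(i,j)=\#B_n(i,j)$ for integers $i,j\ge0$. Then: (1) $B_n(i,j)=\left(12\sqcup\!\sqcup_O^+B_{n-2}(i,j)\right)\uplus\left(12\sqcup\!\sqcup_E^+B_{n-2}(i+1,j)\right)\uplus\left(21\sqcup\!\sqcup_E^+B_{n-2}(i,j+1)\right)\uplus\left(21\sqcup\!\sqcup_O^+B_{n-2}(i+1,j+1)\right)$. (2) $b_{2n}(i,j)=2n^2\,b_{2n-2}(i,j)+2n(n-1)\,b_{2n-2}(i+1,j)$ and $b_{2n+1}(i,j)=2n(n+1)\,b_{2n-1}(i,j)+2n^2\,b_{2n-1}(i+1,j)$. (3) The numbers $c_{2n}(i,j):=b_{2n}(i,j)/(2^{n-1}n!)$ and $c_{2n+1}(i,j):=b_{2n+1}(i,j)/(2^{n-1}n!)$ are integers and satisfy $c_{2n}(i,j)=n\,c_{2n-2}(i,j)+(n-1)\,c_{2n-2}(i+1,j)$ and $c_{2n+1}(i,j)=(n+1)\,c_{2n-1}(i,j)+n\,c_{2n-1}(i+1,j)$. (4) $b_n(i,j)=b_n(i+1,j+1)$. (5) $b_{2n}(i,j)=2n\,b_{2n-1}(i,j)$ for all $i,j$.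
   Context: $S_N$ is the symmetric group on $[N]$ ($S_0$ consists of the empty permutation). For $\pi=a_1\cdots a_N\in S_N$: $\mathrm{inv}\,\pi=\#\{(r,s):r<s,\ a_r>a_s\}$; $\mathrm{maj}\,\pi=\sum_{a_i>a_{i+1}}i$; $\mathrm{imaj}\,\pi=\mathrm{maj}\,\pi^{-1}=\sum i$ over those $i$ such that $i+1$ appears to the left of $i$ in $\pi$. $M_N^{k,l}(i,j)=\{\pi\in S_N:\ \mathrm{inv}\,\pi\equiv i\pmod k,\ \mathrm{imaj}\,\pi\equiv j\pmod l\}$ and $m_N^{k,l}(i,j)=\#\{\pi\in S_N:\mathrm{maj}\,\pi\equiv i\pmod k,\ \mathrm{maj}\,\pi^{-1}\equiv j\pmod l\}$, which equals $\#M_N^{k,l}(i,j)$. Let $O=\{1,3,5,\dots\}$ and $E=\{2,4,6,\dots\}$. For $\pi\in\{12,21\}$, a set $G$ of positive integers and $N'\subseteq S_{n-2}$, $\pi\sqcup\!\sqcup_G^+N'$ is the set of all $\tau\in S_n$ such that the values $1,2$ appear in $\tau$ in the relative order given by $\pi$, at positions $i_1<i_2$ with $i_2-i_1\in G$, and the word obtained from $\tau$ by deleting $1$ and $2$ and subtracting $2$ from every remaining entry lies in $N'$. $\uplus$ denotes disjoint union. *)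

theory Defs
  imports Complex_Main "HOL-Combinatorics.Permutations" "HOL-Number_Theory.Cong"
begin

text \<open>Permutations of \<open>[N] = {1..N}\<close> are functions \<open>p\<close> with \<open>p permutes {1..N}\<close>;
  the word \<open>a\<^sub>1 \<dots> a\<^sub>N\<close> of \<open>p\<close> is \<open>p 1, \<dots>, p N\<close>, and the size \<open>N\<close> is passed explicitly.\<close>

definition Sym :: "nat \<Rightarrow> (nat \<Rightarrow> nat) set" where
  "Sym N = {p. p permutes {1..N}}"

definition word :: "nat \<Rightarrow> (nat \<Rightarrow> nat) \<Rightarrow> nat list" where
  "word N p = map p [1..<Suc N]"

definition inv_stat :: "nat \<Rightarrow> (nat \<Rightarrow> nat) \<Rightarrow> nat" where
  "inv_stat N p = card {(r, s). r \<in> {1..N} \<and> s \<in> {1..N} \<and> r < s \<and> p r > p s}"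

definition maj :: "nat \<Rightarrow> (nat \<Rightarrow> nat) \<Rightarrow> nat" where
  "maj N p = \<Sum> {i \<in> {1..<N}. p i > p (i + 1)}"

definition imaj :: "nat \<Rightarrow> (nat \<Rightarrow> nat) \<Rightarrow> nat" where
  "imaj N p = maj N (inv p)"

definition M_set :: "nat \<Rightarrow> nat \<Rightarrow> nat \<Rightarrow> nat \<Rightarrow> nat \<Rightarrow> (nat \<Rightarrow> nat) set" where
  "M_set k l N i j = {p \<in> Sym N. [inv_stat N p = i] (mod k) \<and> [imaj N p = j] (mod l)}"

definition m_num :: "nat \<Rightarrow> nat \<Rightarrow> nat \<Rightarrow> nat \<Rightarrow> nat \<Rightarrow> nat" where
  "m_num k l N i j = card {p \<in> Sym N. [maj N p = i] (mod k) \<and> [maj N (inv p) = j] (mod l)}"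

definition B_set :: "nat \<Rightarrow> nat \<Rightarrow> nat \<Rightarrow> (nat \<Rightarrow> nat) set" where
  "B_set N i j = M_set 2 2 N i j"

definition b_num :: "nat \<Rightarrow> nat \<Rightarrow> nat \<Rightarrow> nat" where
  "b_num N i j = m_num 2 2 N i j"

text \<open>One formula covers both parities: \<open>N div 2\<close> is \<open>n\<close> for \<open>N = 2n\<close> and for \<open>N = 2n + 1\<close>.\<close>

definition c_num :: "nat \<Rightarrow> nat \<Rightarrow> nat \<Rightarrow> rat" where
  "c_num N i j =
     of_nat (b_num N i j) / (2 powi (int (N div 2) - 1) * fact (N div 2))"

definition perm12 :: "nat \<Rightarrow> nat" where
  "perm12 = id"

definition perm21 :: "nat \<Rightarrow> nat" where
  "perm21 = transpose 1 2"

text \<open>\<open>shuffle_plus n \<pi> G N'\<close> is \<open>\<pi> \<squnion>\<squnion>\<^sub>G\<^sup>+ N'\<close> for \<open>\<pi> \<in> {12, 21}\<close> and \<open>N' \<subseteq> Sym (n - 2)\<close>, \<open>n \<ge> 2\<close>: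
  \<open>\<pi> 1, \<pi> 2\<close> is the order in which the values \<open>1, 2\<close> appear, at positions \<open>i\<^sub>1 < i\<^sub>2\<close>.\<close>

definition shuffle_plus ::
  "nat \<Rightarrow> (nat \<Rightarrow> nat) \<Rightarrow> nat set \<Rightarrow> (nat \<Rightarrow> nat) set \<Rightarrow> (nat \<Rightarrow> nat) set" where
  "shuffle_plus n \<pi> G N' = {\<tau> \<in> Sym n.
     (\<exists>i\<^sub>1 i\<^sub>2. i\<^sub>1 < i\<^sub>2 \<and> \<tau> i\<^sub>1 = \<pi> 1 \<and> \<tau> i\<^sub>2 = \<pi> 2 \<and> i\<^sub>2 - i\<^sub>1 \<in> G) \<and>
     (\<exists>\<sigma>\<in>N'. word (n - 2) \<sigma> = map (\<lambda>a. a - 2) (filter (\<lambda>a. a \<notin> {1, 2}) (word n \<tau>)))}"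

definition Odds :: "nat set" where
  "Odds = {g. odd g}"

definition Evens :: "nat set" where
  "Evens = {g. 0 < g \<and> even g}"

definition is_disjoint_union :: "'a set \<Rightarrow> 'a set list \<Rightarrow> bool" where
  "is_disjoint_union X As \<longleftrightarrow> X = \<Union> (set As) \<and>
     (\<forall>p < length As. \<forall>q < length As. p \<noteq> q \<longrightarrow> As ! p \<inter> As ! q = {})"

end

theory Submission
  imports Defs
begin

text \<open>
  Modulo 2, \<open>maj p\<close> counts the odd positions at which \<open>p\<close> descends, so it only depends on the relative
  order inside the pairs \<open>{1, 2}, {3, 4}, \<dots>\<close> of positions, and \<open>imaj p\<close> does the same for pairs
  of values. Exchanging the entries at positions \<open>2 k - 1\<close> and \<open>2 k\<close> flips the parity of both \<open>maj\<close> and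
  \<open>inv\<close>, and keeps that of \<open>imaj\<close> unless these entries are themselves a pair. Doing this at the first
  pair of positions not carrying a pair of values is a sign-reversing involution, which reduces
  \<open>\<Sum>(-1)\<^bsup>maj p + imaj p\<^esup>\<close> and \<open>\<Sum>(-1)\<^bsup>inv p + imaj p\<^esup>\<close> to sums over the permutations that map pairs to
  pairs. There \<open>maj\<close>, \<open>imaj\<close> and \<open>inv\<close> agree modulo 2, so both sums equal the number of these
  permutations, which is \<open>2\<^bsup>m\<^esup> m!\<close> with \<open>m = n div 2\<close>. As \<open>\<Sum>(-1)\<^bsup>maj p\<^esup> = \<Sum>(-1)\<^bsup>inv p\<^esup> = \<Sum>(-1)\<^bsup>imaj p\<^esup> = 0\<close>
  for \<open>n \<ge> 2\<close>, this gives \<open>4 b\<^sub>n(i, j) = n! + (-1)\<^bsup>i + j\<^esup> 2\<^bsup>m\<^esup> m!\<close> for either definition of \<open>b\<^sub>n\<close>,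
  and all the numerical claims follow. The set decomposition comes from comparing a permutation
  with the one obtained by deleting the values 1 and 2.
\<close>

section \<open>Sign sums and basic facts on permutations\<close>

lemma cong_2_iff: "[a = b] (mod 2) \<longleftrightarrow> even a = even b" for a b :: nat
  unfolding cong_def by presburger

text \<open>Reindexing along the involution \<open>h\<close> turns the sum into its own negative.
  Fixed points of \<open>h\<close> are covered, since \<open>f\<close> vanishes there.\<close>

lemma sum_eq_0_sign_reversing:
  fixes f :: "'a \<Rightarrow> int"
  assumes "\<And>x. x \<in> S \<Longrightarrow> h x \<in> S" "\<And>x. x \<in> S \<Longrightarrow> h (h x) = x"
    and "\<And>x. x \<in> S \<Longrightarrow> f (h x) = - f x"
  shows "sum f S = 0"
proof -
  have "sum f S = sum (\<lambda>x. - f x) S"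
    by (rule sum.reindex_bij_witness[of _ h h]) (auto simp: assms)
  then show ?thesis by (simp add: sum_negf)
qed

lemma finite_Sym: "finite (Sym n)"
  unfolding Sym_def by (rule finite_permutations) simp

lemma card_Sym: "card (Sym n) = fact n"
  unfolding Sym_def by (rule card_permutations) auto

lemma Sym_inv: "p \<in> Sym n \<Longrightarrow> inv p \<in> Sym n"
  by (simp add: Sym_def permutes_inv)

lemma Sym_inv_inv: "p \<in> Sym n \<Longrightarrow> inv (inv p) = p"
  by (simp add: Sym_def permutes_inv_inv)

lemma Sym_comp: "p \<in> Sym n \<Longrightarrow> q \<in> Sym n \<Longrightarrow> p \<circ> q \<in> Sym n"
  by (simp add: Sym_def permutes_compose)

lemma Sym_transpose: "a \<in> {1..n} \<Longrightarrow> b \<in> {1..n} \<Longrightarrow> transpose a b \<in> Sym n"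
  by (simp add: Sym_def permutes_swap_id)

lemma Sym_inj: "p \<in> Sym n \<Longrightarrow> p x = p y \<longleftrightarrow> x = y"
  by (auto simp: Sym_def dest: permutes_inj injD)

lemma Sym_in: "p \<in> Sym n \<Longrightarrow> p x \<in> {1..n} \<longleftrightarrow> x \<in> {1..n}"
  unfolding Sym_def mem_Collect_eq by (rule permutes_in_image)

lemma Sym_inv_apply: "p \<in> Sym n \<Longrightarrow> inv p (p x) = x" "p \<in> Sym n \<Longrightarrow> p (inv p x) = x"
  by (auto simp: Sym_def permutes_inverses)

subsection \<open>Parity of the statistics\<close>

definition odd_descents :: "nat \<Rightarrow> (nat \<Rightarrow> nat) \<Rightarrow> nat set" where
  "odd_descents n p = {i \<in> {1..<n}. odd i \<and> p i > p (i + 1)}"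

definition inversions :: "nat \<Rightarrow> (nat \<Rightarrow> nat) \<Rightarrow> (nat \<times> nat) set" where
  "inversions n p = {(r, s). r \<in> {1..n} \<and> s \<in> {1..n} \<and> r < s \<and> p r > p s}"

lemma inv_stat_eq_card: "inv_stat n p = card (inversions n p)"
  by (simp add: inv_stat_def inversions_def)

lemma finite_odd_descents: "finite (odd_descents n p)"
  by (simp add: odd_descents_def)

lemma finite_inversions: "finite (inversions n p)"
  by (rule finite_subset[of _ "{1..n} \<times> {1..n}"]) (auto simp: inversions_def)

lemma even_maj_iff: "even (maj n p) \<longleftrightarrow> even (card (odd_descents n p))"
proof -
  have "{a \<in> {i \<in> {1..<n}. p i > p (i + 1)}. odd a} = odd_descents n p"
    by (auto simp: odd_descents_def)
  then show ?thesis
    unfolding maj_def by (subst even_sum_iff) auto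
qed

lemma even_card_iff_odd_card:
  assumes "finite A" "finite B" "card (A - {x}) = card (B - {x})" "x \<in> A \<longleftrightarrow> x \<notin> B"
  shows "even (card A) \<longleftrightarrow> odd (card B)"
proof (cases "x \<in> A")
  case True
  then have "B - {x} = B" using assms(4) by auto
  then have "card A = Suc (card B)" using card.remove[OF assms(1) True] assms(3) by metis
  then show ?thesis by simp
next
  case False
  then have "A - {x} = A" "x \<in> B" using assms(4) by auto
  then have "card B = Suc (card A)" using card.remove[OF assms(2)] assms(3) by metis
  then show ?thesis by simp
qed

text \<open>For odd \<open>a\<close> the neighbouring comparisons at \<open>a - 1\<close> and
  \<open>a + 1\<close> sit at even positions and do not count modulo 2, so the swap changes only the
  comparison at \<open>a\<close>, which it reverses.\<close>

lemma even_maj_comp_transpose: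
  assumes p: "p \<in> Sym n" and a: "odd a" "a < n"
  shows "even (maj n (p \<circ> transpose a (Suc a))) \<longleftrightarrow> odd (maj n p)"
  unfolding even_maj_iff
proof (rule even_card_iff_odd_card[where x = a])
  have "odd_descents n (p \<circ> transpose a (Suc a)) - {a} = odd_descents n p - {a}"
    using a by (auto simp: odd_descents_def transpose_def)
  then show "card (odd_descents n (p \<circ> transpose a (Suc a)) - {a}) = card (odd_descents n p - {a})"
    by (rule arg_cong)
  have "a \<ge> 1" using a by (cases a) auto
  moreover have "p a \<noteq> p (Suc a)" using Sym_inj[OF p] by auto
  ultimately show "a \<in> odd_descents n (p \<circ> transpose a (Suc a)) \<longleftrightarrow> a \<notin> odd_descents n p"
    using a by (auto simp: odd_descents_def)
qed (rule finite_odd_descents)+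

text \<open>An adjacent swap keeps the order of every pair of positions except
  \<open>(a, Suc a)\<close>. It therefore matches the remaining inversions bijectively and toggles
  this single one.\<close>

lemma even_inv_stat_comp_transpose:
  assumes p: "p \<in> Sym n" and a: "1 \<le> a" "a < n"
  shows "even (inv_stat n (p \<circ> transpose a (Suc a))) \<longleftrightarrow> odd (inv_stat n p)"
proof -
  define t where "t = transpose a (Suc a)"
  define A where "A = inversions n (p \<circ> t)"
  define B where "B = inversions n p"
  have tt: "t (t x) = x" for x by (simp add: t_def)
  have tl: "t r < t s" if "r < s" "(r, s) \<noteq> (a, Suc a)" for r s
    using that by (auto simp: t_def transpose_def)
  have tin: "t r \<in> {1..n} \<longleftrightarrow> r \<in> {1..n}" for r
    using a by (auto simp: t_def transpose_def)
  have ne: "(t r, t s) \<noteq> (a, Suc a)" if "r < s" for r s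
    using that by (auto simp: t_def transpose_def split: if_splits)
  have "bij_betw (map_prod t t) (A - {(a, Suc a)}) (B - {(a, Suc a)})"
  proof (rule bij_betw_byWitness[where f' = "map_prod t t"])
    show "map_prod t t ` (A - {(a, Suc a)}) \<subseteq> B - {(a, Suc a)}"
      using tl tin ne by (auto simp: A_def B_def inversions_def simp del: atLeastAtMost_iff)
    show "map_prod t t ` (B - {(a, Suc a)}) \<subseteq> A - {(a, Suc a)}"
      using tl tin ne by (auto simp: A_def B_def inversions_def tt simp del: atLeastAtMost_iff)
  qed (auto simp: tt)
  then have eq: "card (A - {(a, Suc a)}) = card (B - {(a, Suc a)})"
    by (rule bij_betw_same_card)
  have fin: "finite A" "finite B" by (simp_all add: A_def B_def finite_inversions)
  have "p a \<noteq> p (Suc a)" using Sym_inj[OF p] by auto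
  then have "(a, Suc a) \<in> A \<longleftrightarrow> (a, Suc a) \<notin> B"
    using a by (auto simp: A_def B_def inversions_def t_def)
  then have "even (card A) \<longleftrightarrow> odd (card B)"
    using eq fin by (intro even_card_iff_odd_card)
  then show ?thesis
    by (simp add: A_def B_def t_def inv_stat_def inversions_def)
qed

subsection \<open>The centralizer of the pairing involution\<close>

text \<open>The involution exchanging \<open>2 k - 1\<close> and \<open>2 k\<close>. For odd
  \<open>n\<close> the last position is fixed, and so is everything outside \<open>{1..n}\<close>,
  which lets commutation with it be required at all arguments.\<close>

definition partner :: "nat \<Rightarrow> nat \<Rightarrow> nat" where
  "partner n i = (if odd i \<and> i < n then i + 1 else if even i \<and> 0 < i \<and> i \<le> n then i - 1 else i)"

lemma partner_partner [simp]: "partner n (partner n i) = i"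
  by (auto simp: partner_def)

lemma partner_odd: "odd a \<Longrightarrow> a < n \<Longrightarrow> partner n a = Suc a"
  by (simp add: partner_def)

lemma partner_even: "even a \<Longrightarrow> 0 < a \<Longrightarrow> a \<le> n \<Longrightarrow> partner n a = a - 1"
  by (simp add: partner_def)

lemma partner_in: "partner n i \<in> {1..n} \<longleftrightarrow> i \<in> {1..n}"
  by (auto simp: partner_def)

lemma partner_eq_self_iff: "i \<in> {1..n} \<Longrightarrow> partner n i = i \<longleftrightarrow> odd n \<and> i = n"
  by (auto simp: partner_def)

text \<open>These permutations carry pairs to pairs, possibly reversing them: a copy of the
  hyperoctahedral group of rank \<open>n div 2\<close>.\<close>

definition block_perms :: "nat \<Rightarrow> (nat \<Rightarrow> nat) set" where
  "block_perms n = {p \<in> Sym n. \<forall>i. p (partner n i) = partner n (p i)}"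

lemma block_perms_inv:
  assumes "p \<in> block_perms n"
  shows "inv p \<in> block_perms n"
proof -
  have p: "p \<in> Sym n" and com: "\<And>i. p (partner n i) = partner n (p i)"
    using assms by (auto simp: block_perms_def)
  have "inv p (partner n i) = partner n (inv p i)" for i
    using com[of "inv p i"] Sym_inv_apply[OF p] by metis
  then show ?thesis using Sym_inv[OF p] by (simp add: block_perms_def)
qed

text \<open>On the inverse the swap acts by exchanging the values \<open>a\<close> and
  \<open>Suc a\<close>. This affects the comparison at \<open>i\<close> only if \<open>i\<close> and
  \<open>i + 1\<close> are the two swapped entries of \<open>p\<close>, and for odd \<open>i\<close>
  such entries would be partners.\<close>

lemma even_imaj_comp_transpose:
  assumes p: "p \<in> Sym n" and a: "odd a" "a < n" and ne: "p (Suc a) \<noteq> partner n (p a)"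
  shows "even (imaj n (p \<circ> transpose a (Suc a))) \<longleftrightarrow> even (imaj n p)"
proof -
  have "1 \<le> a" using a by (cases a) auto
  then have t: "transpose a (Suc a) \<in> Sym n" using a by (intro Sym_transpose) auto
  have inv: "inv (p \<circ> transpose a (Suc a)) = transpose a (Suc a) \<circ> inv p"
    using p t by (simp add: Sym_def permutes_inv_o permutes_bij o_inv_distrib)
  have "transpose a (Suc a) (inv p i) > transpose a (Suc a) (inv p (i + 1)) \<longleftrightarrow> inv p i > inv p (i + 1)"
    if i: "i \<in> {1..<n}" "odd i" for i
  proof -
    have "\<not> (inv p i = a \<and> inv p (i + 1) = Suc a)" "\<not> (inv p (i + 1) = a \<and> inv p i = Suc a)"
      using ne i Sym_inv_apply(2)[OF p] by (metis Suc_eq_plus1 atLeastLessThan_iff partner_odd partner_partner)+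
    then show ?thesis by (auto simp: transpose_def)
  qed
  then have "odd_descents n (transpose a (Suc a) \<circ> inv p) = odd_descents n (inv p)"
    by (auto simp: odd_descents_def)
  then show ?thesis by (simp add: imaj_def even_maj_iff inv)
qed

text \<open>\<open>X\<close> is left abstract to serve both \<open>maj\<close> and
  \<open>inv\<close>. Permutations outside \<open>block_perms n\<close> cancel in stages, according
  to the first pair of positions whose entries are not partners.\<close>

lemma sum_block_perms:
  assumes "\<And>p a. p \<in> Sym n \<Longrightarrow> odd a \<Longrightarrow> a < n \<Longrightarrow>
      even (X (p \<circ> transpose a (Suc a))) \<longleftrightarrow> odd (X p)"
  shows "(\<Sum>p\<in>Sym n. (-1 :: int) ^ (X p + imaj n p)) = (\<Sum>p\<in>block_perms n. (-1) ^ (X p + imaj n p))"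
proof -
  let ?f = "\<lambda>p. (-1 :: int) ^ (X p + imaj n p)"
  \<comment> \<open>The chain descends from \<open>S 0 = Sym n\<close> to
    \<open>S n = block_perms n\<close>; \<open>S k - S (Suc k)\<close> holds the permutations whose
    first failure is at \<open>k\<close>.\<close>
  define S where "S k = {p \<in> Sym n. \<forall>a<k. odd a \<longrightarrow> a < n \<longrightarrow> p (Suc a) = partner n (p a)}" for k
  have fin: "finite (S k)" for k by (simp add: S_def finite_Sym)
  have step: "sum ?f (S (Suc k)) = sum ?f (S k)" for k
  proof (cases "odd k \<and> k < n")
    case False
    then have "S (Suc k) = S k" by (auto simp: S_def less_Suc_eq)
    then show ?thesis by simp
  next
    case True
    then have k: "odd k" "k < n" "1 \<le> k" by (auto elim: oddE)
    define t where "t = transpose k (Suc k)"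
    have t: "t \<in> Sym n" unfolding t_def using k by (intro Sym_transpose) auto
    have sub: "S (Suc k) \<subseteq> S k" by (auto simp: S_def)
    have D: "S k - S (Suc k) = {p \<in> S k. p (Suc k) \<noteq> partner n (p k)}"
      using k by (auto simp: S_def less_Suc_eq)
    have "sum ?f (S k - S (Suc k)) = 0"
    proof (rule sum_eq_0_sign_reversing[where h = "\<lambda>p. p \<circ> t"])
      fix p assume "p \<in> S k - S (Suc k)"
      then have p: "p \<in> S k" "p (Suc k) \<noteq> partner n (p k)" "p \<in> Sym n"
        by (auto simp: D) (auto simp: S_def)
      have "(p \<circ> t) (Suc a) = partner n ((p \<circ> t) a)" if "a < k" "odd a" "a < n" for a
      proof -
        \<comment> \<open>Both \<open>a\<close> and \<open>k\<close> are odd, so the earlier pair is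
          disjoint from \<open>{k, Suc k}\<close> and \<open>t\<close> leaves it alone.\<close>
        have "Suc a \<noteq> k" using that k by auto
        then have "t a = a" "t (Suc a) = Suc a" using that by (auto simp: t_def)
        then show ?thesis using p(1) that by (simp add: S_def)
      qed
      then have "p \<circ> t \<in> S k"
        unfolding S_def using Sym_comp[OF p(3) t] by auto
      moreover have "(p \<circ> t) (Suc k) \<noteq> partner n ((p \<circ> t) k)"
        using p(2) by (metis t_def comp_apply partner_partner transpose_apply_first transpose_apply_second)
      ultimately show "p \<circ> t \<in> S k - S (Suc k)" by (simp add: D)
      show "p \<circ> t \<circ> t = p" by (simp add: t_def fun_eq_iff)
      have "even (X (p \<circ> t)) \<longleftrightarrow> odd (X p)" "even (imaj n (p \<circ> t)) \<longleftrightarrow> even (imaj n p)"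
        unfolding t_def using assms[OF p(3)] even_imaj_comp_transpose[OF p(3)] p(2) k by auto
      then show "?f (p \<circ> t) = - ?f p" by (simp add: minus_one_power_iff)
    qed
    then show ?thesis using sum.subset_diff[OF sub fin, of ?f] by simp
  qed
  have "sum ?f (S k) = sum ?f (Sym n)" for k
    by (induction k) (simp_all add: step, simp add: S_def)
  moreover have "S n = block_perms n"
  proof
    show "block_perms n \<subseteq> S n"
      by (auto simp: S_def block_perms_def) (metis partner_odd)
    show "S n \<subseteq> block_perms n"
    proof
      fix p assume "p \<in> S n"
      then have p: "p \<in> Sym n" and odd: "\<And>a. odd a \<Longrightarrow> a < n \<Longrightarrow> p (Suc a) = partner n (p a)"
        by (auto simp: S_def)
      have ne: "p (partner n i) = partner n (p i)" if i: "i \<in> {1..n}" "partner n i \<noteq> i" for i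
      proof (cases "odd i")
        case True
        then have "i < n" using i by (auto simp: partner_def split: if_splits)
        then show ?thesis using odd[OF True] True by (simp add: partner_odd)
      next
        case False
        then have "p (Suc (i - 1)) = partner n (p (i - 1))" using i by (intro odd) auto
        then show ?thesis using i False by (simp add: partner_even)
      qed
      have "p (partner n i) = partner n (p i)" for i
      proof (cases "i \<in> {1..n}")
        case True
        show ?thesis
        proof (cases "partner n i = i")
          case self: True
          show ?thesis
          proof (rule ccontr)
            assume *: "p (partner n i) \<noteq> partner n (p i)"
            \<comment> \<open>Here \<open>i\<close> is the unpaired last position. If its value had
              a partner, that partner would sit at a paired position \<open>x\<close>, and
              commutation at \<open>x\<close> would force \<open>partner n x = i\<close>, although
              \<open>i\<close> is its own partner.\<close>
            define x where "x = inv p (partner n (p i))"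
            have x: "p x = partner n (p i)" by (simp add: x_def Sym_inv_apply[OF p])
            have xin: "x \<in> {1..n}" using True x Sym_in[OF p] partner_in by metis
            have "x \<noteq> i" using * self x by auto
            then have "partner n x \<noteq> x"
              using self True xin partner_eq_self_iff by metis
            then have "p (partner n x) = p i" using ne[OF xin] x by simp
            then have "partner n x = i" using Sym_inj[OF p] by simp
            then show False using self \<open>x \<noteq> i\<close> by (metis partner_partner)
          qed
        qed (use True ne in auto)
      next
        case False
        then have "partner n i = i" "p i = i"
          using p by (auto simp: partner_def Sym_def permutes_def)
        then show ?thesis by simp
      qed
      then show "p \<in> block_perms n" using p by (simp add: block_perms_def)
    qed
  qed
  ultimately show ?thesis by metis
qed

section \<open>Agreement of the parities on block permutations\<close>

lemma card_odd_descents_inv: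
  assumes p: "p \<in> block_perms n"
  shows "card (odd_descents n (inv p)) = card (odd_descents n p)"
proof -
  \<comment> \<open>An odd descent of a block permutation is a pair sent to a reversed pair; the
    smaller value of that pair is then an odd descent of the inverse. Stating this for every block
    permutation allows its use for \<open>inv p\<close> too.\<close>
  have key: "p (i + 1) \<in> odd_descents n (inv p) \<and> p (i + 1) + 1 = p i"
    if p: "p \<in> block_perms n" and i: "i \<in> odd_descents n p" for p i
  proof -
    have i: "1 \<le> i" "i < n" "odd i" "p (i + 1) < p i" using i by (auto simp: odd_descents_def)
    have S: "p \<in> Sym n" using p by (simp add: block_perms_def)
    have "p (partner n i) = partner n (p i)" using p by (simp add: block_perms_def)
    then have e: "p (i + 1) = partner n (p i)" using i by (simp add: partner_odd)
    then have "even (p i)" "p i \<le> n" "p (i + 1) = p i - 1" "0 < p i"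
      using i Sym_in[OF S, of i] by (auto simp: partner_def split: if_splits)
    then have "p (i + 1) + 1 = p i" "odd (p (i + 1))" "p (i + 1) < n" by auto
    then show ?thesis
      using Sym_inv_apply(1)[OF S] by (auto simp: odd_descents_def elim: oddE)
  qed
  have S: "p \<in> Sym n" using p by (simp add: block_perms_def)
  note q = block_perms_inv[OF p]
  have k1: "p (i + 1) \<in> odd_descents n (inv p)" "inv p (p (i + 1) + 1) = i"
    if "i \<in> odd_descents n p" for i
    using key[OF p that] Sym_inv_apply(1)[OF S] by auto
  have k2: "inv p (i + 1) \<in> odd_descents n p" "p (inv p (i + 1) + 1) = i"
    if "i \<in> odd_descents n (inv p)" for i
    using key[OF q that] Sym_inv_apply[OF S] Sym_inv_inv[OF S] by auto
  have "bij_betw (\<lambda>i. p (i + 1)) (odd_descents n p) (odd_descents n (inv p))"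
    by (rule bij_betw_byWitness[where f' = "\<lambda>i. inv p (i + 1)"]) (use k1 k2 in auto)
  then show ?thesis by (simp add: bij_betw_same_card)
qed

lemma even_imaj_block_perm:
  "p \<in> block_perms n \<Longrightarrow> even (imaj n p) \<longleftrightarrow> even (maj n p)"
  by (simp add: imaj_def even_maj_iff card_odd_descents_inv)

text \<open>\<open>partner n\<close> moves numbers by at most one, so only gaps of one or two are
  critical. There parity decides: even numbers never move up and odd ones never move down.\<close>

lemma partner_less_partner:
  assumes "r < s" "s \<noteq> partner n r"
  shows "partner n r < partner n s"
proof -
  have gen: "partner n x \<le> x + 1" "x \<le> partner n x + 1" for x by (auto simp: partner_def)
  have ev: "partner n x \<le> x" if "even x" for x using that by (simp add: partner_def)
  have od: "x \<le> partner n x" if "odd x" for x using that by (simp add: partner_def)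
  consider "r + 2 < s" | "s = r + 2" | "s = r + 1" "even r" | "s = r + 1" "odd r" "n \<le> r"
    using assms by (cases "odd r"; cases "n \<le> r") (force simp: partner_def)+
  then show ?thesis
  proof cases
    case 1
    then show ?thesis using gen(1)[of r] gen(2)[of s] by linarith
  next
    case 2
    then show ?thesis using gen(1)[of r] gen(2)[of s] ev[of r] od[of s] by (cases "odd r") auto
  next
    case 3
    then show ?thesis using ev[of r] od[of s] by simp
  next
    case 4
    then show ?thesis by (simp add: partner_def)
  qed
qed

text \<open>Applying \<open>partner n\<close> to both positions pairs off the inversions between
  different pairs without fixed points, so their number is even. The inversions inside a pair are
  the odd descents.\<close>

lemma even_inv_stat_block_perm:
  assumes p: "p \<in> block_perms n"
  shows "even (inv_stat n p) \<longleftrightarrow> even (maj n p)"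
proof -
  define f where "f = map_prod (partner n) (partner n)"
  define I where "I = inversions n p"
  define P where "P = {(r, s) \<in> I. s = partner n r}"
  \<comment> \<open>Splitting by the parity of the first position makes the pairing a bijection
    between two halves.\<close>
  define Q where "Q b = {(r, s) \<in> I. s \<noteq> partner n r \<and> odd r = b}" for b
  have S: "p \<in> Sym n" using p by (simp add: block_perms_def)
  have com: "p (partner n r) = partner n (p r)" for r using p by (simp add: block_perms_def)
  have "f x \<in> Q (\<not> b) \<and> f (f x) = x" if "x \<in> Q b" for b x
  proof -
    obtain r s where x: "x = (r, s)" by fastforce
    have rs: "r \<in> {1..n}" "s \<in> {1..n}" "r < s" "p s < p r" "s \<noteq> partner n r" "odd r = b"
      using that by (auto simp: Q_def I_def inversions_def x)
    have "partner n s \<noteq> r" using rs by auto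
    then have "p r \<noteq> partner n (p s)" using com Sym_inj[OF S] by metis
    then have "p (partner n s) < p (partner n r)"
      using rs partner_less_partner com by metis
    moreover have "partner n r < partner n s" using rs partner_less_partner by blast
    \<comment> \<open>As \<open>r < s \<le> n\<close>, the position \<open>r\<close> is not the
      unpaired one, so its parity really changes.\<close>
    moreover have "odd (partner n r) \<noteq> b"
      using rs by (auto simp: partner_def)
    ultimately show ?thesis
      using rs partner_in[of n r] partner_in[of n s] 
      by (auto simp: Q_def I_def inversions_def x f_def simp del: atLeastAtMost_iff)
  qed
  then have "bij_betw f (Q True) (Q False)"
    by (intro bij_betw_byWitness[where f' = f]) force+
  then have c: "card (Q True) = card (Q False)" by (rule bij_betw_same_card)
  have fin: "finite I" by (simp add: I_def finite_inversions)
  then have fP: "finite P" and fQ: "finite (Q b)" for b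
    by (auto simp: P_def Q_def intro: finite_subset[OF _ fin])
  have "I = P \<union> (Q True \<union> Q False)" by (auto simp: P_def Q_def)
  moreover have disj: "P \<inter> (Q True \<union> Q False) = {}" by (auto simp: P_def Q_def)
  ultimately have "card I = card P + card (Q True \<union> Q False)"
    using card_Un_disjoint[OF fP, of "Q True \<union> Q False"] fQ disj by simp
  also have "card (Q True \<union> Q False) = card (Q True) + card (Q False)"
    by (rule card_Un_disjoint[OF fQ fQ]) (auto simp: Q_def)
  finally have "even (card I) \<longleftrightarrow> even (card P)" using c by auto
  moreover have "bij_betw fst P (odd_descents n p)"
    by (rule bij_betw_byWitness[where f' = "\<lambda>i. (i, i + 1)"])
      (auto simp: P_def I_def inversions_def odd_descents_def partner_def split: if_splits)
  ultimately show ?thesis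
    by (simp add: even_maj_iff bij_betw_same_card inv_stat_def I_def inversions_def)
qed

section \<open>Counting the block permutations\<close>

lemma partner_Sym: "partner n \<in> Sym n"
  unfolding Sym_def permutes_def mem_Collect_eq
proof (intro conjI allI impI)
  show "partner n x = x" if "x \<notin> {1..n}" for x
    using that by (auto simp: partner_def)
  show "\<exists>!x. partner n x = y" for y by (metis partner_partner)
qed

lemma block_perms_comp: "p \<in> block_perms n \<Longrightarrow> q \<in> block_perms n \<Longrightarrow> p \<circ> q \<in> block_perms n"
  by (auto simp: block_perms_def intro: Sym_comp)

lemma finite_block_perms: "finite (block_perms n)"
  by (simp add: block_perms_def finite_Sym)

text \<open>An even target is reached by exchanging its whole pair with the last pair; an odd one by
  composing further with \<open>partner (2 * m)\<close>. This makes the fibres over the image of the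
  last point equinumerous.\<close>

lemma block_perms_transitive:
  assumes v: "v \<in> {1..2 * m}"
  shows "\<exists>t\<in>block_perms (2 * m). t (2 * m) = v"
proof -
  have ev: "\<exists>t\<in>block_perms (2 * m). t (2 * m) = v" if v: "v \<in> {1..2 * m}" "even v" for v
  proof -
    define t where "t = transpose (2 * m) v \<circ> transpose (2 * m - 1) (v - 1)"
    have "2 \<le> v" using v by (cases "v = 1") auto
    then have "t \<in> Sym (2 * m)"
      unfolding t_def using v by (intro Sym_comp Sym_transpose) auto
    moreover have "t (partner (2 * m) i) = partner (2 * m) (t i)" for i
    proof -
      obtain u where u: "v = 2 * u" "1 \<le> u" "u \<le> m"
        using that[of "v div 2"] v \<open>2 \<le> v\<close> by auto
      \<comment> \<open>The points of the two exchanged pairs: \<open>t\<close> fixes everything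
        outside \<open>K\<close>, and \<open>partner\<close> preserves both \<open>K\<close> and its
        complement.\<close>
      define K where "K = {2 * m, 2 * m - 1, 2 * u, 2 * u - 1}"
      have "partner (2 * m) k \<in> K" if "k \<in> K" for k
        using that u by (auto simp: K_def partner_def)
      then have out: "partner (2 * m) i \<notin> K" if "i \<notin> K"
        using that by (metis partner_partner)
      have "t k = k" if "k \<notin> K" for k
        using that by (auto simp: t_def K_def u transpose_def)
      then have "?thesis" if "i \<notin> K" using that out by simp
      moreover have "?thesis" if "i \<in> K"
      proof (cases "u = m")
        case True
        then show ?thesis using u by (simp add: t_def)
      next
        case False
        then have "u < m" using u by simp
        then show ?thesis
          using that u unfolding K_def t_def by (elim insertE emptyE) (simp_all add: transpose_def partner_def, presburger+)
      qed
      ultimately show ?thesis by blast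
    qed
    moreover have "t (2 * m) = v"
      using \<open>2 \<le> v\<close> v by (auto simp: t_def transpose_def)
    ultimately show ?thesis by (auto simp: block_perms_def)
  qed
  show ?thesis
  proof (cases "even v")
    case False
    then have "Suc v \<in> {1..2 * m}" using v by (cases "v = 2 * m") auto
    then obtain t where t: "t \<in> block_perms (2 * m)" "t (2 * m) = Suc v"
      using ev[of "Suc v"] False by auto
    have "partner (2 * m) \<in> block_perms (2 * m)"
      by (simp add: block_perms_def partner_Sym)
    then have "partner (2 * m) \<circ> t \<in> block_perms (2 * m)" using t by (intro block_perms_comp)
    moreover have "(partner (2 * m) \<circ> t) (2 * m) = v"
      using t False \<open>Suc v \<in> _\<close> by (simp add: partner_even)
    ultimately show ?thesis by blast
  qed (use ev v in blast)
qed

text \<open>Fixing the last point forces its partner \<open>2 * m + 1\<close> to be fixed. Since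
  permutations are identities outside their domain, this stabilizer is literally the smaller
  group.\<close>

lemma block_perms_fixing_last:
  "{p \<in> block_perms (2 * m + 2). p (2 * m + 2) = 2 * m + 2} = block_perms (2 * m)"
proof (intro equalityI subsetI)
  let ?N = "2 * m + 2"
  have pa: "partner (2 * m) i = (if i \<in> {1..2 * m} then partner ?N i else i)" for i
    by (auto simp: partner_def)
  {
    fix p assume "p \<in> {p \<in> block_perms ?N. p ?N = ?N}"
    then have p: "p \<in> Sym ?N" "\<And>i. p (partner ?N i) = partner ?N (p i)" "p ?N = ?N"
      by (auto simp: block_perms_def)
    have "p (2 * m + 1) = 2 * m + 1" using p(2)[of ?N] p(3) by (simp add: partner_def)
    then have "p x = x" if "x \<in> {1..?N} - {1..2 * m}" for x
    proof -
      have "x = 2 * m + 1 \<or> x = ?N" using that by auto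
      then show ?thesis using p(3) \<open>p (2 * m + 1) = 2 * m + 1\<close> by auto
    qed
    then have S: "p \<in> Sym (2 * m)"
      using p(1) permutes_superset[of p "{1..?N}" "{1..2 * m}"] by (simp add: Sym_def)
    have "p (partner (2 * m) i) = partner (2 * m) (p i)" for i
      using p(2)[of i] Sym_in[OF S, of i] by (simp add: pa)
    then show "p \<in> block_perms (2 * m)" using S by (simp add: block_perms_def)
  next
    fix p assume "p \<in> block_perms (2 * m)"
    then have p: "p \<in> Sym (2 * m)" "\<And>i. p (partner (2 * m) i) = partner (2 * m) (p i)"
      by (auto simp: block_perms_def)
    have out: "p x = x" if "x \<notin> {1..2 * m}" for x
      using p(1) that by (auto simp: Sym_def permutes_def)
    have S: "p \<in> Sym ?N" using p(1) unfolding Sym_def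
      by (auto intro: permutes_subset)
    have "p (partner ?N i) = partner ?N (p i)" for i
    proof (cases "i \<in> {1..2 * m}")
      case True
      then show ?thesis using p(2)[of i] Sym_in[OF p(1), of i] by (simp add: pa)
    next
      case False
      then have "partner ?N i \<notin> {1..2 * m}"
        by (auto simp: partner_def)
      then show ?thesis using out False by simp
    qed
    then show "p \<in> {p \<in> block_perms ?N. p ?N = ?N}"
      using S out by (simp add: block_perms_def)
  }
qed

text \<open>Orbit counting: the image of the last point takes \<open>2 * m + 2\<close> values, each
  equally often, and the stabilizer is the group for \<open>m\<close>.\<close>

lemma card_block_perms_even: "card (block_perms (2 * m)) = 2 ^ m * fact m"
proof (induction m)
  case 0
  have "block_perms 0 = {id}" by (auto simp: block_perms_def Sym_def)
  then show ?case by simp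
next
  case (Suc m)
  let ?N = "2 * m + 2"
  define F where "F v = {p \<in> block_perms ?N. p ?N = v}" for v
  have cF: "card (F v) = card (F ?N)" if v: "v \<in> {1..?N}" for v
  proof -
    obtain t where t: "t \<in> block_perms ?N" "t ?N = v"
      using block_perms_transitive[of v "Suc m"] v by auto
    have tS: "t \<in> Sym ?N" using t by (simp add: block_perms_def)
    have "bij_betw (\<lambda>p. t \<circ> p) (F ?N) (F v)"
      by (rule bij_betw_byWitness[where f' = "\<lambda>p. inv t \<circ> p"])
        (use t block_perms_comp block_perms_inv in
          \<open>auto simp: F_def fun_eq_iff Sym_inv_apply[OF tS]\<close>)
    then show ?thesis by (simp add: bij_betw_same_card)
  qed
  have "block_perms ?N = (\<Union>v\<in>{1..?N}. F v)"
  proof -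
    have "p ?N \<in> {1..?N}" if "p \<in> block_perms ?N" for p
      using that Sym_in[of p ?N ?N] by (simp add: block_perms_def)
    then show ?thesis by (auto simp: F_def)
  qed
  then have "card (block_perms ?N) = (\<Sum>v\<in>{1..?N}. card (F v))"
    by (simp only:) (rule card_UN_disjoint, auto simp: F_def finite_block_perms)
  also have "\<dots> = (\<Sum>v\<in>{1..?N}. card (F ?N))" by (rule sum.cong[OF refl cF])
  also have "\<dots> = ?N * card (F ?N)" by simp
  also have "F ?N = block_perms (2 * m)" unfolding F_def by (rule block_perms_fixing_last)
  finally show ?case using Suc.IH by (simp add: algebra_simps)
qed

text \<open>The extra point is the only unpaired one in range, so commuting with
  \<open>partner\<close> forces it to be fixed.\<close>

lemma block_perms_Suc_even: "block_perms (2 * m + 1) = block_perms (2 * m)"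
proof -
  have pa: "partner (2 * m + 1) = partner (2 * m)"
    by (auto simp: partner_def fun_eq_iff less_Suc_eq le_less)
  have "p \<in> Sym (2 * m + 1) \<longleftrightarrow> p \<in> Sym (2 * m)"
    if com: "\<And>i. p (partner (2 * m + 1) i) = partner (2 * m + 1) (p i)" for p
  proof
    assume p: "p \<in> Sym (2 * m + 1)"
    have "partner (2 * m + 1) (p (2 * m + 1)) = p (2 * m + 1)"
      using com[of "2 * m + 1"] by (simp add: partner_def)
    then have "p (2 * m + 1) = 2 * m + 1"
      using partner_eq_self_iff Sym_in[OF p, of "2 * m + 1"] by simp
    moreover have "{1..2 * m + 1} - {1..2 * m} = {2 * m + 1}" by auto
    ultimately show "p \<in> Sym (2 * m)"
      using p permutes_superset[of p "{1..2 * m + 1}" "{1..2 * m}"] by (simp add: Sym_def)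
  next
    assume "p \<in> Sym (2 * m)"
    then show "p \<in> Sym (2 * m + 1)" by (auto simp: Sym_def intro: permutes_subset)
  qed
  then show ?thesis unfolding block_perms_def pa by blast
qed

lemma card_block_perms: "card (block_perms n) = 2 ^ (n div 2) * fact (n div 2)"
proof (cases "even n")
  case True
  then show ?thesis using card_block_perms_even[of "n div 2"] by simp
next
  case False
  then have "n = 2 * (n div 2) + 1" by simp
  then show ?thesis using card_block_perms_even[of "n div 2"] block_perms_Suc_even[of "n div 2"] by simp
qed

subsection \<open>The closed formula and its consequences\<close>

text \<open>Fourier inversion on pairs of parities: of the four character sums, the trivial one
  gives \<open>n!\<close>, the two single ones vanish, and the mixed one is the number of block
  permutations.\<close>

lemma four_times_card_parity_class:
  assumes n: "n \<ge> 2"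
    and flip: "\<And>p a. p \<in> Sym n \<Longrightarrow> odd a \<Longrightarrow> a < n \<Longrightarrow>
      even (X (p \<circ> transpose a (Suc a))) \<longleftrightarrow> odd (X p)"
    and block: "\<And>p. p \<in> block_perms n \<Longrightarrow> even (X p) \<longleftrightarrow> even (maj n p)"
  shows "4 * int (card {p \<in> Sym n. [X p = i] (mod 2) \<and> [imaj n p = j] (mod 2)}) =
    fact n + (-1) ^ (i + j) * 2 ^ (n div 2) * fact (n div 2)"
proof -
  let ?s = "\<lambda>k. (-1 :: int) ^ k"
  define t :: "nat \<Rightarrow> nat" where "t = transpose 1 (Suc 1)"
  have t: "t \<in> Sym n" unfolding t_def using n by (intro Sym_transpose) auto
  have tt: "t (t x) = x" for x by (simp add: t_def)
  have X0: "(\<Sum>p\<in>Sym n. ?s (X p)) = 0"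
  proof (rule sum_eq_0_sign_reversing[where h = "\<lambda>p. p \<circ> t"])
    fix p assume p: "p \<in> Sym n"
    show "p \<circ> t \<in> Sym n" using p t by (rule Sym_comp)
    show "p \<circ> t \<circ> t = p" by (simp add: fun_eq_iff tt)
    show "?s (X (p \<circ> t)) = - ?s (X p)"
      using flip[OF p, of 1] n by (simp add: t_def minus_one_power_iff)
  qed
  have I0: "(\<Sum>p\<in>Sym n. ?s (imaj n p)) = 0"
  \<comment> \<open>Composition on the left exchanges positions 1 and 2 of the inverse word, hence
    flips \<open>imaj\<close>.\<close>
  proof (rule sum_eq_0_sign_reversing[where h = "\<lambda>p. t \<circ> p"])
    fix p assume p: "p \<in> Sym n"
    show "t \<circ> p \<in> Sym n" using t p by (rule Sym_comp)
    show "t \<circ> (t \<circ> p) = p" by (simp add: fun_eq_iff tt)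
    have "inv (t \<circ> p) = inv p \<circ> t"
      using p t by (simp add: Sym_def permutes_bij o_inv_distrib t_def)
    then show "?s (imaj n (t \<circ> p)) = - ?s (imaj n p)"
      using even_maj_comp_transpose[OF Sym_inv[OF p], of 1] n
      by (simp add: imaj_def t_def minus_one_power_iff)
  qed
  have "(\<Sum>p\<in>Sym n. ?s (X p + imaj n p)) = (\<Sum>p\<in>block_perms n. ?s (X p + imaj n p))"
    using flip by (rule sum_block_perms)
  also have "\<dots> = (\<Sum>p\<in>block_perms n. 1)"
    by (rule sum.cong) (auto simp: minus_one_power_iff block even_imaj_block_perm)
  also have "\<dots> = 2 ^ (n div 2) * fact (n div 2)" by (simp add: card_block_perms)
  finally have XI: "(\<Sum>p\<in>Sym n. ?s (X p + imaj n p)) = 2 ^ (n div 2) * fact (n div 2)" .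
  let ?P = "\<lambda>p. [X p = i] (mod 2) \<and> [imaj n p = j] (mod 2)"
  have "4 * int (card {p \<in> Sym n. ?P p}) = (\<Sum>p\<in>Sym n. 4 * of_bool (?P p))"
    by (simp add: finite_Sym sum_of_bool_eq Int_def flip: sum_distrib_left)
  \<comment> \<open>The summand is \<open>(1 + (-1)^(i + X p)) (1 + (-1)^(j + imaj n p))\<close>
    expanded: it is 4 on the parity class and 0 elsewhere.\<close>
  also have "\<dots> = (\<Sum>p\<in>Sym n. 1 + ?s i * ?s (X p) + ?s j * ?s (imaj n p) + ?s (i + j) * ?s (X p + imaj n p))"
    by (rule sum.cong) (auto simp: cong_2_iff minus_one_power_iff)
  also have "\<dots> = int (card (Sym n)) + ?s i * (\<Sum>p\<in>Sym n. ?s (X p)) + ?s j * (\<Sum>p\<in>Sym n. ?s (imaj n p))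
      + ?s (i + j) * (\<Sum>p\<in>Sym n. ?s (X p + imaj n p))"
    by (simp only: sum.distrib sum_distrib_left) simp
  finally show ?thesis by (simp only: X0 I0 XI card_Sym) simp
qed

lemma four_times_b_num:
  "n \<ge> 2 \<Longrightarrow> 4 * int (b_num n i j) = fact n + (-1) ^ (i + j) * 2 ^ (n div 2) * fact (n div 2)"
  using four_times_card_parity_class[of n "maj n" i j] even_maj_comp_transpose
  by (simp add: b_num_def m_num_def imaj_def)

lemma four_times_card_B_set:
  "n \<ge> 2 \<Longrightarrow> 4 * int (card (B_set n i j)) = fact n + (-1) ^ (i + j) * 2 ^ (n div 2) * fact (n div 2)"
  unfolding B_set_def M_set_def
  by (rule four_times_card_parity_class)
    (simp_all add: even_inv_stat_comp_transpose even_inv_stat_block_perm Suc_leI odd_pos)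

text \<open>The equidistribution follows because both counts obey the same closed formula.\<close>

lemma b_num_eq_card_B_set: "n \<ge> 2 \<Longrightarrow> b_num n i j = card (B_set n i j)"
  using four_times_b_num[of n i j] four_times_card_B_set[of n i j] by simp

lemma b_num_diagonal: "n \<ge> 2 \<Longrightarrow> b_num n i j = b_num n (i + 1) (j + 1)"
  using four_times_b_num[of n i j] four_times_b_num[of n "i + 1" "j + 1"] by simp

text \<open>Raising \<open>i\<close> by one flips the sign of the second term of the closed formula,
  so the two smaller numbers are a factorial plus or minus \<open>S\<close>. The recurrence is then
  a polynomial identity; \<open>n \<ge> 2\<close> lets the formula apply at
  \<open>2 * n - 2\<close>.\<close>

lemma b_num_even_rec:
  assumes "n \<ge> 2"
  shows "b_num (2 * n) i j =
    2 * n\<^sup>2 * b_num (2 * n - 2) i j + 2 * n * (n - 1) * b_num (2 * n - 2) (i + 1) j"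
proof -
  obtain m where n: "n = Suc m" and m: "m \<ge> 1" using assms by (cases n) auto
  define S where "S = (-1 :: int) ^ (i + j) * 2 ^ m * fact m"
  have "4 * int (b_num (2 * n) i j) = (2 * int m + 2) * (2 * int m + 1) * fact (2 * m) + 2 * (int m + 1) * S"
    using four_times_b_num[of "2 * n" i j] by (simp add: n S_def algebra_simps)
  moreover have "4 * int (b_num (2 * m) i j) = fact (2 * m) + S"
    using four_times_b_num[of "2 * m" i j] m by (simp add: S_def)
  moreover have "4 * int (b_num (2 * m) (i + 1) j) = fact (2 * m) - S"
    using four_times_b_num[of "2 * m" "i + 1" j] m by (simp add: S_def)
  ultimately have "4 * int (b_num (2 * n) i j) = 2 * (int m + 1)\<^sup>2 * (4 * int (b_num (2 * m) i j))
      + 2 * (int m + 1) * int m * (4 * int (b_num (2 * m) (i + 1) j))"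
    by algebra
  also have "\<dots> = 4 * int (2 * n\<^sup>2 * b_num (2 * m) i j + 2 * n * m * b_num (2 * m) (i + 1) j)"
    by (simp add: n algebra_simps)
  finally show ?thesis by (simp add: n del: of_nat_add of_nat_mult of_nat_power)
qed

lemma b_num_odd_rec:
  assumes "n \<ge> 2"
  shows "b_num (2 * n + 1) i j =
    2 * n * (n + 1) * b_num (2 * n - 1) i j + 2 * n\<^sup>2 * b_num (2 * n - 1) (i + 1) j"
proof -
  obtain m where n: "n = Suc m" and m: "m \<ge> 1" using assms by (cases n) auto
  have n1: "2 * n - 1 = Suc (2 * m)" by (simp add: n)
  define S where "S = (-1 :: int) ^ (i + j) * 2 ^ m * fact m"
  \<comment> \<open>Keeping this factorial opaque leaves an identity that is polynomial in
    \<open>m\<close>, \<open>F\<close> and \<open>S\<close>.\<close>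
  define F where "F = (fact (Suc (2 * m)) :: int)"
  have "(fact (2 * n + 1) :: int) = (2 * int m + 3) * (2 * int m + 2) * F"
    unfolding F_def n by (simp add: algebra_simps)
  then have "4 * int (b_num (2 * n + 1) i j) = (2 * int m + 3) * (2 * int m + 2) * F + 2 * (int m + 1) * S"
    using four_times_b_num[of "2 * n + 1" i j] m by (simp add: n S_def algebra_simps del: fact_Suc) (simp add: algebra_simps)
  moreover have "4 * int (b_num (Suc (2 * m)) i j) = F + S"
    using four_times_b_num[of "Suc (2 * m)" i j] m by (simp add: S_def F_def del: fact_Suc)
  moreover have "4 * int (b_num (Suc (2 * m)) (i + 1) j) = F - S"
    using four_times_b_num[of "Suc (2 * m)" "i + 1" j] m by (simp add: S_def F_def del: fact_Suc)
  ultimately have "4 * int (b_num (2 * n + 1) i j) =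
      2 * (int m + 1) * (int m + 2) * (4 * int (b_num (Suc (2 * m)) i j))
      + 2 * (int m + 1)\<^sup>2 * (4 * int (b_num (Suc (2 * m)) (i + 1) j))"
    by algebra
  also have "\<dots> = 4 * int (2 * n * (n + 1) * b_num (2 * n - 1) i j + 2 * n\<^sup>2 * b_num (2 * n - 1) (i + 1) j)"
    unfolding n1 by (simp add: n algebra_simps)
  finally show ?thesis by (simp del: of_nat_add of_nat_mult of_nat_power)
qed

lemma b_num_even_eq_odd:
  assumes "n \<ge> 2"
  shows "b_num (2 * n) i j = 2 * n * b_num (2 * n - 1) i j"
proof -
  obtain m where n: "n = Suc m" and m: "m \<ge> 1" using assms by (cases n) auto
  have n1: "2 * n - 1 = Suc (2 * m)" by (simp add: n)
  define S where "S = (-1 :: int) ^ (i + j) * 2 ^ m * fact m"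
  define F where "F = (fact (Suc (2 * m)) :: int)"
  have "(fact (2 * n) :: int) = (2 * int m + 2) * F"
    unfolding F_def n by (simp add: algebra_simps)
  then have "4 * int (b_num (2 * n) i j) = (2 * int m + 2) * F + 2 * (int m + 1) * S"
    using four_times_b_num[of "2 * n" i j] m by (simp add: n S_def algebra_simps del: fact_Suc) (simp add: algebra_simps)
  moreover have "4 * int (b_num (Suc (2 * m)) i j) = F + S"
    using four_times_b_num[of "Suc (2 * m)" i j] m by (simp add: S_def F_def del: fact_Suc)
  ultimately have "4 * int (b_num (2 * n) i j) = 2 * (int m + 1) * (4 * int (b_num (Suc (2 * m)) i j))"
    by algebra
  also have "\<dots> = 4 * int (2 * n * b_num (2 * n - 1) i j)"
    unfolding n1 by (simp add: n algebra_simps)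
  finally show ?thesis by (simp del: of_nat_add of_nat_mult of_nat_power)
qed

section \<open>The normalized numbers\<close>

lemma c_num_eq:
  assumes "m \<ge> 1"
  shows "c_num (2 * m) i j = of_nat (b_num (2 * m) i j) / (2 ^ (m - 1) * fact m)"
    and "c_num (2 * m + 1) i j = of_nat (b_num (2 * m + 1) i j) / (2 ^ (m - 1) * fact m)"
  \<comment> \<open>For \<open>m \<ge> 1\<close> the integer exponent is nonnegative, so
    \<open>powi\<close> is an ordinary power.\<close>
  using assms by (simp_all add: c_num_def power_int_def nat_diff_distrib)

lemma c_num_rec:
  assumes "n \<ge> 2"
  shows "c_num (2 * n) i j =
       of_nat n * c_num (2 * n - 2) i j + of_nat (n - 1) * c_num (2 * n - 2) (i + 1) j"
    and "c_num (2 * n + 1) i j =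
       of_nat (n + 1) * c_num (2 * n - 1) i j + of_nat n * c_num (2 * n - 1) (i + 1) j"
proof -
  obtain m where n: "n = Suc (Suc m)" using assms by (metis add_2_eq_Suc le_Suc_ex)
  have e: "2 * n - 2 = 2 * Suc m" "2 * n - 1 = 2 * Suc m + 1" by (simp_all add: n)
  \<comment> \<open>From \<open>n - 1\<close> to \<open>n\<close> the denominator gains the factor
    \<open>2 * n\<close>, which divides each coefficient in the recurrences of
    \<open>b_num\<close>.\<close>
  have k: "(2::rat) ^ (n - 1) * fact n = 2 * of_nat n * (2 ^ (Suc m - 1) * fact (Suc m))"
    by (simp add: n del: of_nat_Suc)
  define K where "K = (2::rat) ^ (Suc m - 1) * fact (Suc m)"
  have K: "K \<noteq> 0" by (simp add: K_def)
  have n0: "(of_nat n :: rat) \<noteq> 0" using assms by simp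
  show "c_num (2 * n) i j =
       of_nat n * c_num (2 * n - 2) i j + of_nat (n - 1) * c_num (2 * n - 2) (i + 1) j"
    using c_num_eq(1)[of n i j] c_num_eq(1)[of "Suc m"] assms
    by (simp only: e b_num_even_rec k flip: K_def) (use K n0 in \<open>simp add: field_simps power2_eq_square\<close>)
  show "c_num (2 * n + 1) i j =
       of_nat (n + 1) * c_num (2 * n - 1) i j + of_nat n * c_num (2 * n - 1) (i + 1) j"
    using c_num_eq(2)[of n i j] c_num_eq(2)[of "Suc m"] assms
    by (simp only: e b_num_odd_rec k flip: K_def) (use K n0 in \<open>simp add: field_simps power2_eq_square\<close>)
qed

lemma c_num_Ints:
  assumes "n \<ge> 1"
  shows "c_num (2 * n) i j \<in> \<int>" and "c_num (2 * n + 1) i j \<in> \<int>"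
proof -
  have "(\<forall>i j. c_num (2 * n) i j \<in> \<int>) \<and> (\<forall>i j. c_num (2 * n + 1) i j \<in> \<int>)"
    using assms
  proof (induction n rule: dec_induct)
    \<comment> \<open>For \<open>n = 1\<close> the denominator is 1.\<close>
    case base
    then show ?case by (auto simp: c_num_def)
  next
    case (step n)
    have e: "2 * Suc n - 2 = 2 * n" "2 * Suc n - 1 = 2 * n + 1" by simp_all
    have "Suc n \<ge> 2" using step by simp
    then show ?case using c_num_rec[of "Suc n"] step.IH unfolding e by simp
  qed
  then show "c_num (2 * n) i j \<in> \<int>" "c_num (2 * n + 1) i j \<in> \<int>" by auto
qed

subsection \<open>Deleting the values 1 and 2\<close>

text \<open>The increasing enumeration of the positions other than \<open>x < y\<close>.\<close>

definition skip :: "nat \<Rightarrow> nat \<Rightarrow> nat \<Rightarrow> nat" where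
  "skip x y r = (if r < x then r else if r + 1 < y then r + 1 else r + 2)"

lemma skip_less_iff: "x < y \<Longrightarrow> skip x y r < skip x y s \<longleftrightarrow> r < s"
  by (auto simp: skip_def)

lemma skip_image:
  assumes "1 \<le> x" "x < y" "y \<le> n"
  shows "skip x y ` {1..n - 2} = {1..n} - {x, y}"
proof (intro equalityI subsetI)
  fix z assume "z \<in> skip x y ` {1..n - 2}"
  then show "z \<in> {1..n} - {x, y}" using assms by (auto simp: skip_def)
next
  fix z assume z: "z \<in> {1..n} - {x, y}"
  \<comment> \<open>The inverse of \<open>skip\<close>: one step down beyond \<open>x\<close>, two
    steps down beyond \<open>y\<close>.\<close>
  let ?r = "if z < x then z else if z < y then z - 1 else z - 2"
  have "skip x y ?r = z" using z assms by (auto simp: skip_def)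
  moreover have "?r \<in> {1..n - 2}" using z assms by auto
  ultimately show "z \<in> skip x y ` {1..n - 2}" by (metis imageI)
qed

lemma inj_skip: "x < y \<Longrightarrow> inj_on (skip x y) A"
  by (rule inj_onI) (metis skip_less_iff linorder_neqE_nat less_irrefl)

text \<open>Both lists are sorted and distinct with the same elements, hence equal.\<close>

lemma filter_positions:
  assumes "1 \<le> x" "x < y" "y \<le> n"
  shows "filter (\<lambda>i. i \<notin> {x, y}) [1..<Suc n] = map (skip x y) [1..<Suc (n - 2)]"
proof (rule sorted_distinct_set_unique)
  have "sorted_wrt (\<lambda>r s. skip x y r \<le> skip x y s) [1..<Suc (n - 2)]"
    by (rule sorted_wrt_mono_rel[OF _ sorted_upt])
      (metis assms(2) less_le_not_le linorder_not_le skip_less_iff)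
  then show "sorted (map (skip x y) [1..<Suc (n - 2)])" by (simp only: sorted_map)
  show "distinct (map (skip x y) [1..<Suc (n - 2)])"
    using inj_skip[OF assms(2)] by (simp add: distinct_map)
  have "set (map (skip x y) [1..<Suc (n - 2)]) = skip x y ` {1..n - 2}"
    by (simp only: set_map set_upt atLeastLessThanSuc_atLeastAtMost)
  also have "\<dots> = set (filter (\<lambda>i. i \<notin> {x, y}) [1..<Suc n])"
    unfolding skip_image[OF assms] by auto
  finally show "set (filter (\<lambda>i. i \<notin> {x, y}) [1..<Suc n]) = set (map (skip x y) [1..<Suc (n - 2)])" ..
qed (simp_all only: sorted_wrt_filter sorted_upt distinct_filter distinct_upt)

text \<open>Leaving open which of 1 and 2 comes first treats the shuffles of 12 and 21
  together.\<close>

locale small_positions =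
  fixes n :: nat and \<tau> :: "nat \<Rightarrow> nat" and x y :: nat
  assumes tau: "\<tau> \<in> Sym n" and less: "x < y" and small: "{\<tau> x, \<tau> y} = {1, 2}" and n2: "n \<ge> 2"
begin

lemma x_in: "x \<in> {1..n}" and y_in: "y \<in> {1..n}"
proof -
  have "\<tau> x \<in> {1, 2}" "\<tau> y \<in> {1, 2}" using small by auto
  then have "\<tau> x \<in> {1..n}" "\<tau> y \<in> {1..n}" using n2 by auto
  then show "x \<in> {1..n}" "y \<in> {1..n}" using Sym_in[OF tau] by auto
qed

lemma bounds: "1 \<le> x" "x < y" "y \<le> n"
  using x_in y_in less by auto

lemma small_iff: "\<tau> i \<in> {1, 2} \<longleftrightarrow> i \<in> {x, y}"
  using Sym_inj[OF tau, of i] small by (metis insert_iff singleton_iff)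

lemma skip_in: "r \<in> {1..n - 2} \<Longrightarrow> skip x y r \<in> {1..n} - {x, y}"
  using skip_image[OF bounds] by blast

lemma tau_skip: "r \<in> {1..n - 2} \<Longrightarrow> \<tau> (skip x y r) \<in> {3..n}"
proof -
  assume "r \<in> {1..n - 2}"
  from skip_in[OF this] have "\<tau> (skip x y r) \<in> {1..n}" "\<tau> (skip x y r) \<notin> {1, 2}"
    using Sym_in[OF tau] small_iff by blast+
  then show ?thesis by auto
qed

lemma word_iff:
  "word (n - 2) \<sigma> = map (\<lambda>a. a - 2) (filter (\<lambda>a. a \<notin> {1, 2}) (word n \<tau>)) \<longleftrightarrow>
    (\<forall>r\<in>{1..n - 2}. \<tau> (skip x y r) = \<sigma> r + 2)"
proof -
  have "filter (\<lambda>a. a \<notin> {1, 2}) (word n \<tau>) = map \<tau> (filter (\<lambda>i. i \<notin> {x, y}) [1..<Suc n])"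
    unfolding word_def filter_map comp_def small_iff ..
  also have "\<dots> = map (\<lambda>r. \<tau> (skip x y r)) [1..<Suc (n - 2)]"
    unfolding filter_positions[OF bounds] by simp
  finally have "word (n - 2) \<sigma> = map (\<lambda>a. a - 2) (filter (\<lambda>a. a \<notin> {1, 2}) (word n \<tau>)) \<longleftrightarrow>
    (\<forall>r\<in>{1..n - 2}. \<sigma> r = \<tau> (skip x y r) - 2)"
    unfolding word_def by (simp only: map_map comp_def map_eq_conv set_upt atLeastLessThanSuc_atLeastAtMost)
  \<comment> \<open>The remaining entries are at least 3, so the truncated subtraction of 2 is
    exact.\<close>
  also have "\<dots> \<longleftrightarrow> (\<forall>r\<in>{1..n - 2}. \<tau> (skip x y r) = \<sigma> r + 2)"
    using tau_skip by (intro ball_cong refl) fastforce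
  finally show ?thesis .
qed

lemma reduction_exists: "\<exists>\<sigma>\<in>Sym (n - 2). \<forall>r\<in>{1..n - 2}. \<tau> (skip x y r) = \<sigma> r + 2"
proof -
  \<comment> \<open>The identity outside the range is what \<open>permutes\<close> demands; inside,
    an injective self-map of a finite set is onto.\<close>
  define \<sigma> where "\<sigma> r = (if r \<in> {1..n - 2} then \<tau> (skip x y r) - 2 else r)" for r
  have eq: "\<tau> (skip x y r) = \<sigma> r + 2" if "r \<in> {1..n - 2}" for r
    using tau_skip[OF that] that by (auto simp: \<sigma>_def)
  have inj: "inj_on \<sigma> {1..n - 2}"
  proof (rule inj_onI)
    fix r s assume rs: "r \<in> {1..n - 2}" "s \<in> {1..n - 2}" "\<sigma> r = \<sigma> s"
    then have "\<tau> (skip x y r) = \<tau> (skip x y s)" using eq by simp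
    then have "skip x y r = skip x y s" using Sym_inj[OF tau] by simp
    then show "r = s" using inj_skip[OF less, of UNIV] by (simp add: inj_eq)
  qed
  have "\<sigma> ` {1..n - 2} \<subseteq> {1..n - 2}" using tau_skip by (fastforce simp: \<sigma>_def)
  then have "bij_betw \<sigma> {1..n - 2} {1..n - 2}"
    using inj by (simp add: bij_betw_def endo_inj_surj)
  then have "\<sigma> \<in> Sym (n - 2)"
    unfolding Sym_def mem_Collect_eq by (rule bij_imp_permutes) (simp only: \<sigma>_def if_False)
  then show ?thesis using eq by blast
qed

context
  fixes \<sigma> :: "nat \<Rightarrow> nat"
  assumes sigma: "\<sigma> \<in> Sym (n - 2)"
    and skip: "\<And>r. r \<in> {1..n - 2} \<Longrightarrow> \<tau> (skip x y r) = \<sigma> r + 2"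
begin

text \<open>Every other entry exceeds 1 and 2, so the small entries at \<open>x\<close> and
  \<open>y\<close> form inversions with all positions to their left, except that
  \<open>(x, y)\<close> is none if 1 comes first. The correction stands on the left to avoid a
  subtraction.\<close>

lemma inv_stat_reduction:
  "inv_stat n \<tau> + of_bool (\<tau> x = 1) = inv_stat (n - 2) \<sigma> + (x - 1) + (y - 1)"
proof -
  let ?f = "map_prod (skip x y) (skip x y)"
  \<comment> \<open>Inversions are sorted by their right end: \<open>X\<close> ends at
    \<open>x\<close>, \<open>Y\<close> ends at \<open>y\<close>, and \<open>I\<close> comes from
    \<open>\<sigma>\<close>.\<close>
  define I where "I = ?f ` inversions (n - 2) \<sigma>"
  define X where "X = (\<lambda>r. (r, x)) ` {1..<x}"
  define Y where "Y = (\<lambda>r. (r, y)) ` ({1..<y} - (if \<tau> x = 1 then {x} else {}))"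
  have big: "\<tau> i > 2" if "i \<in> {1..n}" "i \<notin> {x, y}" for i
    using small_iff[of i] that Sym_in[OF tau, of i] by force
  have xy: "\<tau> x = 1 \<and> \<tau> y = 2 \<or> \<tau> x = 2 \<and> \<tau> y = 1"
    using small by (auto simp: doubleton_eq_iff)
  have "inversions n \<tau> = I \<union> (X \<union> Y)"
  proof (intro equalityI subsetI)
    fix z assume "z \<in> inversions n \<tau>"
    then obtain r s where z: "z = (r, s)" and rs: "r \<in> {1..n}" "s \<in> {1..n}" "r < s" "\<tau> s < \<tau> r"
      by (auto simp: inversions_def)
    show "z \<in> I \<union> (X \<union> Y)"
    proof (cases "s \<in> {x, y}")
      case True
      then show ?thesis using z rs xy by (auto simp: X_def Y_def)
    next
      case False
      then have "\<tau> s > 2" using big rs by blast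
      then have "r \<notin> {x, y}" using rs small_iff[of r] by auto
      then have "r \<in> skip x y ` {1..n - 2}" "s \<in> skip x y ` {1..n - 2}"
        using False rs skip_image[OF bounds] by blast+
      then obtain r' s' where r's': "r' \<in> {1..n - 2}" "s' \<in> {1..n - 2}" "r = skip x y r'" "s = skip x y s'"
        by blast
      then have "(r', s') \<in> inversions (n - 2) \<sigma>"
        using rs skip[of r'] skip[of s'] skip_less_iff[OF less] by (auto simp: inversions_def)
      then show ?thesis unfolding I_def z r's' by force
    qed
  next
    fix z assume "z \<in> I \<union> (X \<union> Y)"
    then consider "z \<in> I" | "z \<in> X" | "z \<in> Y" by blast
    then show "z \<in> inversions n \<tau>"
    proof cases
      case 1
      then obtain r s where z: "z = (skip x y r, skip x y s)"
        and rs: "r \<in> {1..n - 2}" "s \<in> {1..n - 2}" "r < s" "\<sigma> s < \<sigma> r"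
        by (auto simp: I_def inversions_def)
      then show ?thesis
        using skip[of r] skip[of s] skip_in[of r] skip_in[of s] skip_less_iff[OF less]
        by (auto simp: inversions_def)
    next
      case 2
      then obtain r where r: "z = (r, x)" "1 \<le> r" "r < x" by (auto simp: X_def)
      then have "\<tau> r > 2" using bounds by (intro big) auto
      then show ?thesis using r xy bounds by (auto simp: inversions_def)
    next
      case 3
      then obtain r where z: "z = (r, y)" "r \<in> {1..<y} - (if \<tau> x = 1 then {x} else {})"
        unfolding Y_def by blast
      then have r: "z = (r, y)" "1 \<le> r" "r < y" "\<not> (r = x \<and> \<tau> x = 1)" by auto
      show ?thesis
      proof (cases "r = x")
        case True
        then show ?thesis using r xy bounds by (auto simp: inversions_def)
      next
        case False
        then have "\<tau> r > 2" using r bounds by (intro big) auto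
        then show ?thesis using r xy bounds by (auto simp: inversions_def)
      qed
    qed
  qed
  moreover have "I \<inter> (X \<union> Y) = {}"
    using skip_in by (force simp: I_def X_def Y_def inversions_def)
  moreover have "finite I" "finite X" "finite Y"
    by (simp_all add: I_def X_def Y_def finite_inversions)
  moreover have "X \<inter> Y = {}" using less by (auto simp: X_def Y_def)
  ultimately have "card (inversions n \<tau>) = card I + (card X + card Y)"
    by (simp add: card_Un_disjoint)
  moreover have "card I = card (inversions (n - 2) \<sigma>)"
    unfolding I_def by (rule card_image) (intro map_prod_inj_on[THEN inj_on_subset] inj_skip less, auto)
  moreover have "card X = x - 1" unfolding X_def by (subst card_image) (auto simp: inj_on_def)
  moreover have "card Y = y - 1 - of_bool (\<tau> x = 1)"
    unfolding Y_def using bounds by (subst card_image) (auto simp: inj_on_def)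
  ultimately show ?thesis
    unfolding inv_stat_eq_card using bounds by (cases "\<tau> x = 1") simp_all
qed

text \<open>For values above 2, \<open>inv \<tau>\<close> is \<open>inv \<sigma>\<close> shifted by
  2 and followed by the increasing map \<open>skip\<close>, so odd descents correspond. The
  comparison of 2 with 3 is at an even place; at place 1 there is a descent iff 2 stands before
  1.\<close>

lemma even_imaj_reduction:
  "even (imaj n \<tau>) \<longleftrightarrow> (even (imaj (n - 2) \<sigma>) \<longleftrightarrow> \<tau> x = 1)"
proof -
  let ?s = "\<lambda>v :: nat. v + 2"
  have xy: "\<tau> x = 1 \<and> \<tau> y = 2 \<or> \<tau> x = 2 \<and> \<tau> y = 1"
    using small by (auto simp: doubleton_eq_iff)
  have inv_eq: "inv \<tau> (v + 2) = skip x y (inv \<sigma> v)" if "v \<in> {1..n - 2}" for v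
  proof -
    have "inv \<sigma> v \<in> {1..n - 2}" using Sym_in[OF Sym_inv[OF sigma]] that by blast
    from skip[OF this] have "\<tau> (skip x y (inv \<sigma> v)) = v + 2"
      by (simp add: Sym_inv_apply[OF sigma])
    then show ?thesis using Sym_inv_apply(1)[OF tau] by metis
  qed
  have shift: "odd_descents n (inv \<tau>) - {1} = ?s ` odd_descents (n - 2) (inv \<sigma>)"
  proof (intro equalityI subsetI)
    fix i assume "i \<in> odd_descents n (inv \<tau>) - {1}"
    then have i: "1 < i" "i < n" "odd i" "inv \<tau> i > inv \<tau> (i + 1)" by (auto simp: odd_descents_def)
    define v where "v = i - 2"
    have "i \<noteq> 2" using i by auto
    then have v: "i = v + 2" "odd v" "1 \<le> v" "v + 2 < n" using i by (auto simp: v_def)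
    then have "inv \<sigma> v > inv \<sigma> (v + 1)"
      using i inv_eq[of v] inv_eq[of "v + 1"] skip_less_iff[OF less] by (simp add: less_diff_conv)
    then have "v \<in> odd_descents (n - 2) (inv \<sigma>)" using v by (auto simp: odd_descents_def)
    then show "i \<in> ?s ` odd_descents (n - 2) (inv \<sigma>)" using v by blast
  next
    fix i assume "i \<in> ?s ` odd_descents (n - 2) (inv \<sigma>)"
    then obtain v where v: "i = v + 2" "1 \<le> v" "v < n - 2" "odd v" "inv \<sigma> v > inv \<sigma> (v + 1)"
      by (auto simp: odd_descents_def)
    then have "inv \<tau> (v + 2) > inv \<tau> (v + 1 + 2)"
      using inv_eq[of v] inv_eq[of "v + 1"] skip_less_iff[OF less] by simp
    then show "i \<in> odd_descents n (inv \<tau>) - {1}" using v by (auto simp: odd_descents_def)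
  qed
  have one: "1 \<in> odd_descents n (inv \<tau>) \<longleftrightarrow> \<tau> x \<noteq> 1"
  proof -
    have "inv \<tau> (\<tau> x) = x" "inv \<tau> (\<tau> y) = y" using Sym_inv_apply(1)[OF tau] by auto
    then have "inv \<tau> 1 > inv \<tau> 2 \<longleftrightarrow> \<tau> x \<noteq> 1" using xy less by auto
    then show ?thesis using n2 by (simp add: odd_descents_def numeral_2_eq_2)
  qed
  have rest: "card (odd_descents n (inv \<tau>) - {1}) = card (odd_descents (n - 2) (inv \<sigma>))"
    unfolding shift by (rule card_image) (simp add: inj_on_def)
  have split: "card (odd_descents n (inv \<tau>)) =
      card (odd_descents n (inv \<tau>) - {1}) + of_bool (1 \<in> odd_descents n (inv \<tau>))"
  proof (cases "1 \<in> odd_descents n (inv \<tau>)")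
    case True
    then show ?thesis
      unfolding card.remove[OF finite_odd_descents True] by simp
  qed simp
  have "even (card (odd_descents n (inv \<tau>))) \<longleftrightarrow>
      even (card (odd_descents (n - 2) (inv \<sigma>)) + of_bool (\<tau> x \<noteq> 1))"
    by (simp only: split one rest)
  then show ?thesis
    unfolding imaj_def even_maj_iff by (cases "\<tau> x = 1") simp_all
qed

end

text \<open>By injectivity of \<open>\<tau>\<close> the positions in the definition can only be
  \<open>x\<close> and \<open>y\<close>.\<close>

lemma shuffle_plus_iff:
  assumes "{\<pi> 1, \<pi> 2} = {1, 2}"
  shows "\<tau> \<in> shuffle_plus n \<pi> G N' \<longleftrightarrow> \<tau> x = \<pi> 1 \<and> \<tau> y = \<pi> 2 \<and> y - x \<in> G \<and>
    (\<exists>\<sigma>\<in>N'. \<forall>r\<in>{1..n - 2}. \<tau> (skip x y r) = \<sigma> r + 2)"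
proof -
  have "i1 = x \<and> i2 = y" if "i1 < i2" "\<tau> i1 = \<pi> 1" "\<tau> i2 = \<pi> 2" for i1 i2
  proof -
    have "i1 \<in> {x, y}" "i2 \<in> {x, y}" using that assms small_iff[of i1] small_iff[of i2] by auto
    then show ?thesis using that less by auto
  qed
  then show ?thesis
    unfolding shuffle_plus_def mem_Collect_eq word_iff using tau less by blast
qed

text \<open>This eliminates \<open>\<sigma>\<close>: membership becomes a Boolean condition on
  parities read off from \<open>\<tau>\<close>, which makes the decomposition propositional.\<close>

lemma shuffle_plus_B_set_iff:
  assumes \<pi>: "{\<pi> 1, \<pi> 2} = {1, 2}"
  shows "\<tau> \<in> shuffle_plus n \<pi> G (B_set (n - 2) i j) \<longleftrightarrow> \<tau> x = \<pi> 1 \<and> \<tau> y = \<pi> 2 \<and> y - x \<in> G \<and>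
    (even i \<longleftrightarrow> (even (inv_stat n \<tau>) \<longleftrightarrow> (odd (y - x) \<longleftrightarrow> \<tau> x = 1))) \<and>
    (even j \<longleftrightarrow> (even (imaj n \<tau>) \<longleftrightarrow> \<tau> x = 1))"
proof -
  have inv: "even (inv_stat (n - 2) \<sigma>) \<longleftrightarrow> (even (inv_stat n \<tau>) \<longleftrightarrow> (odd (y - x) \<longleftrightarrow> \<tau> x = 1))"
    and imaj: "even (imaj (n - 2) \<sigma>) \<longleftrightarrow> (even (imaj n \<tau>) \<longleftrightarrow> \<tau> x = 1)"
    if "\<sigma> \<in> Sym (n - 2)" "\<forall>r\<in>{1..n - 2}. \<tau> (skip x y r) = \<sigma> r + 2" for \<sigma>
  proof -
    have "inv_stat n \<tau> + of_bool (\<tau> x = 1) = inv_stat (n - 2) \<sigma> + (x - 1) + (y - 1)"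
      using inv_stat_reduction[of \<sigma>] that by blast
    moreover have "even (x - 1 + (y - 1)) \<longleftrightarrow> even (y - x)" using bounds by auto
    ultimately have "even (inv_stat n \<tau> + of_bool (\<tau> x = 1)) \<longleftrightarrow> (even (inv_stat (n - 2) \<sigma>) \<longleftrightarrow> even (y - x))"
      by (simp add: add.assoc)
    then show "even (inv_stat (n - 2) \<sigma>) \<longleftrightarrow> (even (inv_stat n \<tau>) \<longleftrightarrow> (odd (y - x) \<longleftrightarrow> \<tau> x = 1))"
      by (cases "\<tau> x = 1") auto
    show "even (imaj (n - 2) \<sigma>) \<longleftrightarrow> (even (imaj n \<tau>) \<longleftrightarrow> \<tau> x = 1)"
      using even_imaj_reduction[of \<sigma>] that by auto
  qed
  \<comment> \<open>The parity conditions mention no \<open>\<sigma>\<close>, so the converse needs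
    this reduced permutation as its witness.\<close>
  obtain \<sigma> where \<sigma>: "\<sigma> \<in> Sym (n - 2)" "\<forall>r\<in>{1..n - 2}. \<tau> (skip x y r) = \<sigma> r + 2"
    using reduction_exists by blast
  have B: "\<sigma> \<in> B_set (n - 2) i j \<longleftrightarrow> \<sigma> \<in> Sym (n - 2) \<and>
      even (inv_stat (n - 2) \<sigma>) = even i \<and> even (imaj (n - 2) \<sigma>) = even j" for \<sigma>
    by (auto simp: B_set_def M_set_def cong_2_iff)
  have "(\<exists>\<sigma>\<in>B_set (n - 2) i j. \<forall>r\<in>{1..n - 2}. \<tau> (skip x y r) = \<sigma> r + 2) \<longleftrightarrow>
    (even i \<longleftrightarrow> (even (inv_stat n \<tau>) \<longleftrightarrow> (odd (y - x) \<longleftrightarrow> \<tau> x = 1))) \<and>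
    (even j \<longleftrightarrow> (even (imaj n \<tau>) \<longleftrightarrow> \<tau> x = 1))"
    (is "?L \<longleftrightarrow> ?R")
  proof
    assume ?L
    then obtain \<rho> where \<rho>: "\<rho> \<in> B_set (n - 2) i j" "\<forall>r\<in>{1..n - 2}. \<tau> (skip x y r) = \<rho> r + 2" by blast
    then have "\<rho> \<in> Sym (n - 2)" by (simp add: B)
    then show ?R using inv[OF _ \<rho>(2)] imaj[OF _ \<rho>(2)] \<rho>(1) unfolding B by argo
  next
    assume ?R
    then have "\<sigma> \<in> B_set (n - 2) i j" using inv[OF \<sigma>] imaj[OF \<sigma>] \<sigma>(1) unfolding B by argo
    then show ?L using \<sigma>(2) by blast
  qed
  then show ?thesis unfolding shuffle_plus_iff[OF \<pi>] by blast
qed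

end

section \<open>The disjoint decomposition\<close>

lemma ex_small_positions:
  assumes "\<tau> \<in> Sym n" "n \<ge> 2"
  obtains x y where "small_positions n \<tau> x y"
proof -
  have v: "\<tau> (inv \<tau> 1) = 1" "\<tau> (inv \<tau> 2) = 2" using Sym_inv_apply(2)[OF assms(1)] by auto
  then have "inv \<tau> 1 \<noteq> inv \<tau> 2" by (metis numeral_eq_one_iff semiring_norm(85))
  then consider "inv \<tau> 1 < inv \<tau> 2" | "inv \<tau> 2 < inv \<tau> 1" by linarith
  then show ?thesis
  proof cases
    case 1
    then show ?thesis using v assms by (intro that[of "inv \<tau> 1" "inv \<tau> 2"]) (simp add: small_positions_def)
  next
    case 2
    then show ?thesis using v assms by (intro that[of "inv \<tau> 2" "inv \<tau> 1"])
      (simp add: small_positions_def insert_commute)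
  qed
qed

lemma is_disjoint_union_four:
  assumes "X = A \<union> B \<union> C \<union> D"
    and "A \<inter> B = {}" "A \<inter> C = {}" "A \<inter> D = {}" "B \<inter> C = {}" "B \<inter> D = {}" "C \<inter> D = {}"
  shows "is_disjoint_union X [A, B, C, D]"
proof -
  have "[A, B, C, D] ! p \<inter> [A, B, C, D] ! q = {}" if "p < 4" "q < 4" "p \<noteq> q" for p q
  proof -
    have "p \<in> {0, 1, 2, 3}" "q \<in> {0, 1, 2, 3}" using that by auto
    then show ?thesis using that assms(2-) by (elim insertE emptyE) (simp_all add: Int_commute)
  qed
  then show ?thesis using assms(1) by (auto simp: is_disjoint_union_def)
qed

text \<open>The order of 1 and 2 and the parity of their distance single out one of the four
  shuffles; the shifts of \<open>i\<close> and \<open>j\<close> record how deletion changes the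
  parities of \<open>inv\<close> and \<open>imaj\<close>.\<close>

lemma B_set_disjoint_union:
  assumes "n \<ge> 2"
  shows "is_disjoint_union (B_set n i j)
       [shuffle_plus n perm12 Odds (B_set (n - 2) i j),
        shuffle_plus n perm12 Evens (B_set (n - 2) (i + 1) j),
        shuffle_plus n perm21 Evens (B_set (n - 2) i (j + 1)),
        shuffle_plus n perm21 Odds (B_set (n - 2) (i + 1) (j + 1))]"
    (is "is_disjoint_union ?X [?A, ?B, ?C, ?D]")
proof -
  have key: "(\<tau> \<in> ?X \<longleftrightarrow> \<tau> \<in> ?A \<union> ?B \<union> ?C \<union> ?D) \<and>
      \<tau> \<notin> ?A \<inter> ?B \<and> \<tau> \<notin> ?A \<inter> ?C \<and> \<tau> \<notin> ?A \<inter> ?D \<and> \<tau> \<notin> ?B \<inter> ?C \<and> \<tau> \<notin> ?B \<inter> ?D \<and> \<tau> \<notin> ?C \<inter> ?D" for \<tau>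
  proof (cases "\<tau> \<in> Sym n")
    case False
    then show ?thesis by (auto simp: B_set_def M_set_def shuffle_plus_def)
  next
    case True
    then obtain x y where "small_positions n \<tau> x y" using ex_small_positions assms by blast
    then interpret small_positions n \<tau> x y .
    have p12: "{perm12 1, perm12 2} = {1, 2}" and p21: "{perm21 1, perm21 2} = {1, 2}"
      by (auto simp: perm12_def perm21_def)
    have xy: "\<tau> x = 1 \<and> \<tau> y = 2 \<or> \<tau> x = 2 \<and> \<tau> y = 1"
      using small by (auto simp: doubleton_eq_iff)
    have X: "\<tau> \<in> ?X \<longleftrightarrow> even (inv_stat n \<tau>) = even i \<and> even (imaj n \<tau>) = even j"
      using True by (auto simp: B_set_def M_set_def cong_2_iff)
    \<comment> \<open>\<open>Evens\<close> excludes 0, which is harmless because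
      \<open>x < y\<close>.\<close>
    have G: "y - x \<in> Odds \<longleftrightarrow> odd (y - x)" "y - x \<in> Evens \<longleftrightarrow> even (y - x)"
      using less by (auto simp: Odds_def Evens_def)
    have p: "perm12 1 = 1" "perm12 2 = 2" "perm21 1 = 2" "perm21 2 = 1"
      by (auto simp: perm12_def perm21_def)
    show ?thesis
      unfolding X Un_iff Int_iff shuffle_plus_B_set_iff[OF p12] shuffle_plus_B_set_iff[OF p21] G p even_add
      using xy by (elim disjE; cases "odd (y - x)") auto
  qed
  show ?thesis
    by (rule is_disjoint_union_four) (use key in blast)+
qed

theorem theorem5p5:
  fixes n i j :: nat
  assumes "n \<ge> 2"
  shows
    "b_num n i j = card (B_set n i j) \<and>
     is_disjoint_union (B_set n i j)
       [shuffle_plus n perm12 Odds (B_set (n - 2) i j),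
        shuffle_plus n perm12 Evens (B_set (n - 2) (i + 1) j),
        shuffle_plus n perm21 Evens (B_set (n - 2) i (j + 1)),
        shuffle_plus n perm21 Odds (B_set (n - 2) (i + 1) (j + 1))] \<and>
     b_num (2 * n) i j =
       2 * n\<^sup>2 * b_num (2 * n - 2) i j + 2 * n * (n - 1) * b_num (2 * n - 2) (i + 1) j \<and>
     b_num (2 * n + 1) i j =
       2 * n * (n + 1) * b_num (2 * n - 1) i j + 2 * n\<^sup>2 * b_num (2 * n - 1) (i + 1) j \<and>
     c_num (2 * n) i j \<in> \<int> \<and>
     c_num (2 * n + 1) i j \<in> \<int> \<and>
     c_num (2 * n) i j =
       of_nat n * c_num (2 * n - 2) i j + of_nat (n - 1) * c_num (2 * n - 2) (i + 1) j \<and>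
     c_num (2 * n + 1) i j =
       of_nat (n + 1) * c_num (2 * n - 1) i j + of_nat n * c_num (2 * n - 1) (i + 1) j \<and>
     b_num n i j = b_num n (i + 1) (j + 1) \<and>
     b_num (2 * n) i j = 2 * n * b_num (2 * n - 1) i j"
proof -
  have "n \<ge> 1" using assms by simp
  show ?thesis
    by (intro conjI b_num_eq_card_B_set[OF assms] B_set_disjoint_union[OF assms] b_num_even_rec[OF assms]
        b_num_odd_rec[OF assms] c_num_Ints[OF \<open>n \<ge> 1\<close>] c_num_rec[OF assms] b_num_diagonal[OF assms]
        b_num_even_eq_odd[OF assms])
qed

end
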